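(* Let $\mathbf{u}=(u_n)_{n\in\mathbb{N}}$ be a strictly increasing sequence in $\mathbb{N}$, put $u_0:=1$ and $q_n:=\frac{u_n}{u_{n-1}}$ for $n\in\mathbb{N}$. Let $a_k=u_{n_k}$ ($k\in\mathbb{N}$, $n_1<n_2<\dots$) be a subsequence of $(u_n)$ such that $a_k\mid u_i$ for all $i,k\in\mathbb{N}$ with $i\geq n_k$. If $(q_n)$ is bounded, then $$t_{\mathbf{u}}(\mathbb{T})=\varphi\left(\left\langle\left\{\tfrac{1}{a_n}:n\in\mathbb{N}\right\}\right\rangle\right),$$ and this group is the union of the finite subgroups $\langle\varphi(\frac{1}{a_n})\rangle$, $n\in\mathbb{N}$, of $\mathbb{T}$.
   Context: $\mathbb{N}=\{1,2,3,\dots\}$. $\mathbb{T}:=(\mathbb{R},+)/\mathbb{Z}$ is the circle group and $\varphi:\mathbb{R}\to\mathbb{T}$ is the quotient map. $\langle S\rangle$ denotes the subgroup generated by $S$ (in $\mathbb{R}$ or in $\mathbb{T}$, respectively). For a strictly increasing sequence $\mathbf{u}=(u_n)_{n\in\mathbb{N}}$ in $\mathbb{N}$, the subgroup of $\mathbb{T}$ characterized by $\mathbf{u}$ is $t_{\mathbf{u}}(\mathbb{T}):=\{t\in\mathbb{T}: (u_nt)_n \text{ converges to } 0 \text{ in } \mathbb{T}\}=\{\varphi(x): x\in\mathbb{R},\ \Vert u_nx\Vert\to 0\}$, where $\Vert x\Vert:=\min_{k\in\mathbb{Z}}|x-k|$. *)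

theory Defs
  imports "HOL-Analysis.Analysis" "HOL-Algebra.Elementary_Groups"
begin

definition real_group :: "real monoid" where
  "real_group = \<lparr>carrier = UNIV, monoid.mult = (+), one = 0\<rparr>"

definition circle_group :: "real set monoid" where
  "circle_group = real_group Mod \<int>"

definition circle_proj :: "real \<Rightarrow> real set" where
  "circle_proj x = \<int> #>\<^bsub>real_group\<^esub> x"

text \<open>The circle carries the quotient topology of the real line.\<close>

definition circle_topology :: "real set topology" where
  "circle_topology = topology (\<lambda>U. U \<subseteq> carrier circle_group \<and> open (circle_proj -` U))"

text \<open>The function \<^const>\<open>topology\<close> is only meaningful on predicates satisfying
  \<^const>\<open>istopology\<close>.\<close>

lemma openin_circle_topology:
  "openin circle_topology U \<longleftrightarrow> U \<subseteq> carrier circle_group \<and> open (circle_proj -` U)"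
proof -
  have "istopology (\<lambda>U. U \<subseteq> carrier circle_group \<and> open (circle_proj -` U))"
    unfolding istopology_def by (auto simp: vimage_Union)
  then show ?thesis
    by (simp add: circle_topology_def)
qed

text \<open>In the multiplicative notation of HOL-Algebra, the multiple \<open>u n \<cdot> t\<close> is the power
  \<open>t [^] u n\<close>, and the neutral element \<open>\<one>\<close> is the coset \<open>\<int>\<close>.\<close>

definition char_subgroup :: "(nat \<Rightarrow> nat) \<Rightarrow> real set set" where
  "char_subgroup u = {t \<in> carrier circle_group.
     limitin circle_topology (\<lambda>n. t [^]\<^bsub>circle_group\<^esub> u n) \<one>\<^bsub>circle_group\<^esub> sequentially}"

end

theory Submission
  imports Defs
begin

text \<open>Everything reduces to one statement about real numbers: if the distance of
  \<open>u\<^sub>n x\<close> to the nearest integer tends to zero, then \<open>a\<^sub>k x\<close> is an integer for some \<open>k\<close>. To see it, let \<open>M\<close> bound the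
  ratios \<open>q\<^sub>n\<close> and choose \<open>k\<close> so large that every \<open>u\<^sub>i x\<close> with \<open>i \<ge> n\<^sub>k\<close> is within \<open>1/(M+1)\<close> of an
  integer. Write \<open>a\<^sub>k x = m + e\<close> with \<open>m\<close> an integer and \<open>e\<close> small. As \<open>a\<^sub>k\<close> divides \<open>u\<^sub>i\<close>, the number
  \<open>u\<^sub>i x\<close> differs from \<open>(u\<^sub>i/a\<^sub>k) e\<close> by an integer. Passing from \<open>i\<close> to \<open>i+1\<close> multiplies this error by
  at most \<open>M\<close>, so the error cannot jump into the neighbourhood of a nonzero integer; hence it stays
  below \<open>1/(M+1)\<close> forever. Since \<open>u\<^sub>i/a\<^sub>k\<close> is unbounded, \<open>e = 0\<close>. This is the lemma
  \<open>bounded_ratio_imp_Ints\<close>.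

  Conversely, if \<open>a\<^sub>k x\<close> is an integer, then so is \<open>u\<^sub>i x\<close> for all \<open>i \<ge> n\<^sub>k\<close>, and the sequence is
  eventually constant in the circle. So the characterized subgroup is the image of the union over \<open>k\<close>
  of the groups \<open>(1/a\<^sub>k)\<int>\<close>. By divisibility these form an increasing chain, so their union is the
  subgroup generated by all \<open>1/a\<^sub>k\<close>; and each of them has finite image in the circle, as \<open>(1/a\<^sub>k)\<int>\<close>
  meets only \<open>a\<^sub>k\<close> classes modulo \<open>\<int>\<close>.\<close>

section \<open>The real line and the circle as groups\<close>

lemma real_group_simps [simp]:
  "carrier real_group = UNIV" "x \<otimes>\<^bsub>real_group\<^esub> y = x + y" "\<one>\<^bsub>real_group\<^esub> = 0"
  by (simp_all add: real_group_def)

lemma comm_group_real_group: "comm_group real_group"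
proof (rule comm_groupI)
  show "\<exists>y\<in>carrier real_group. y \<otimes>\<^bsub>real_group\<^esub> x = \<one>\<^bsub>real_group\<^esub>" for x
    by (auto intro: exI[of _ "-x"])
qed auto

interpretation real_group: comm_group real_group
  by (rule comm_group_real_group)

lemma inv_real_group [simp]: "inv\<^bsub>real_group\<^esub> x = - x"
  by (rule real_group.inv_equality) auto

lemma int_pow_real_group [simp]: "x [^]\<^bsub>real_group\<^esub> (k :: int) = of_int k * x"
proof -
  have nat_pow: "x [^]\<^bsub>real_group\<^esub> n = of_nat n * x" for n :: nat
    by (induction n) (auto simp: algebra_simps)
  show ?thesis
    by (cases k rule: int_cases2)
       (simp_all add: real_group.int_pow_neg int_pow_int nat_pow)
qed

interpretation Ints: normal "\<int>" real_group
proof (rule real_group.subgroup_imp_normal)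
  show "subgroup \<int> real_group"
    by (rule real_group.subgroupI) auto
qed

lemma group_hom_circle_proj: "group_hom real_group circle_group circle_proj"
  unfolding group_hom_def group_hom_axioms_def circle_group_def circle_proj_def
  using Ints.r_coset_hom_Mod Ints.factorgroup_is_group real_group.group_axioms by simp

interpretation circle_proj: group_hom real_group circle_group circle_proj
  by (rule group_hom_circle_proj)

lemma carrier_circle_group: "carrier circle_group = range circle_proj"
  by (auto simp: circle_group_def FactGroup_def RCOSETS_def circle_proj_def)

lemma circle_proj_eq_iff: "circle_proj x = circle_proj y \<longleftrightarrow> x - y \<in> \<int>"
proof -
  have coset: "w \<in> circle_proj z \<longleftrightarrow> w - z \<in> \<int>" for w z
    by (auto simp: circle_proj_def r_coset_def intro: bexI[where x = "w - z"])
  show ?thesis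
  proof
    assume "circle_proj x = circle_proj y"
    then have "x \<in> circle_proj y"
      using coset[of x x] by simp
    then show "x - y \<in> \<int>"
      by (simp add: coset)
  next
    assume "x - y \<in> \<int>"
    then have "w - x \<in> \<int> \<longleftrightarrow> w - y \<in> \<int>" for w
      using Ints_add[of "w - x" "x - y"] Ints_diff[of "w - y" "x - y"] by auto
    then show "circle_proj x = circle_proj y"
      by (auto simp: coset)
  qed
qed

lemma circle_proj_pow: "circle_proj x [^]\<^bsub>circle_group\<^esub> n = circle_proj (of_nat n * x)"
  for n :: nat
  using circle_proj.hom_nat_pow[of x n] int_pow_real_group[of x "int n"] by (simp add: int_pow_int del: int_pow_real_group)

section \<open>Convergence to zero in the circle\<close>

lemma topspace_circle_topology: "topspace circle_topology = carrier circle_group"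
proof
  show "topspace circle_topology \<subseteq> carrier circle_group"
    using openin_topspace[of circle_topology] unfolding openin_circle_topology by blast
  have "circle_proj -` carrier circle_group = UNIV"
    by (auto simp: carrier_circle_group)
  then show "carrier circle_group \<subseteq> topspace circle_topology"
    by (intro openin_subset) (simp add: openin_circle_topology)
qed

text \<open>The image of \<open>(-\<epsilon>, \<epsilon>)\<close> is a neighbourhood of zero in the circle, because its full preimage is
  the union of the \<open>\<epsilon>\<close>-neighbourhoods of all integers.\<close>

lemma limitin_circle_imp_near_Ints:
  assumes lim: "limitin circle_topology (\<lambda>n. circle_proj (y n)) \<one>\<^bsub>circle_group\<^esub> sequentially"
    and "\<epsilon> > 0"
  shows "\<forall>\<^sub>F n in sequentially. \<exists>m\<in>\<int>. \<bar>y n - m\<bar> < \<epsilon>"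
proof -
  define U where "U = circle_proj ` {-\<epsilon><..<\<epsilon>}"
  have vimage: "circle_proj -` U = (\<Union>m\<in>\<int>. ball m \<epsilon>)"
  proof (intro equalityI subsetI)
    fix x assume "x \<in> circle_proj -` U"
    then obtain z where "- \<epsilon> < z" "z < \<epsilon>" "x - z \<in> \<int>"
      by (auto simp: U_def circle_proj_eq_iff)
    then show "x \<in> (\<Union>m\<in>\<int>. ball m \<epsilon>)"
      by (intro UN_I[of "x - z"]) (auto simp: dist_real_def)
  next
    fix x :: real assume "x \<in> (\<Union>m\<in>\<int>. ball m \<epsilon>)"
    then obtain m :: real where "m \<in> \<int>" "\<bar>m - x\<bar> < \<epsilon>"
      by (auto simp: dist_real_def)
    then have "circle_proj x = circle_proj (x - m)" "x - m \<in> {-\<epsilon><..<\<epsilon>}"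
      by (auto simp: circle_proj_eq_iff)
    then show "x \<in> circle_proj -` U"
      unfolding U_def by blast
  qed
  have "openin circle_topology U"
    unfolding openin_circle_topology vimage
    by (auto simp: U_def carrier_circle_group)
  moreover have "\<one>\<^bsub>circle_group\<^esub> \<in> U"
    using \<open>\<epsilon> > 0\<close> circle_proj.hom_one by (auto simp: U_def intro!: image_eqI[of _ _ 0])
  ultimately have "\<forall>\<^sub>F n in sequentially. circle_proj (y n) \<in> U"
    using lim by (simp add: limitin_def)
  moreover have "\<exists>m\<in>\<int>. \<bar>y n - m\<bar> < \<epsilon>" if "circle_proj (y n) \<in> U" for n
  proof -
    have "y n \<in> (\<Union>m\<in>\<int>. ball m \<epsilon>)"
      using that unfolding vimage[symmetric] by simp
    then show ?thesis
      by (auto simp: dist_real_def abs_minus_commute)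
  qed
  ultimately show ?thesis
    by (rule eventually_mono)
qed

section \<open>Rigidity of approximation along sequences with bounded ratios\<close>

text \<open>A sequence whose consecutive ratios are at most \<open>M\<close> cannot carry a small error past the gap
  between the \<open>1/(M+1)\<close>-neighbourhood of zero and those of the other integers: the other side begins
  at \<open>1 - 1/(M+1) = M/(M+1)\<close>, and one step takes an error below \<open>1/(M+1)\<close> to at most \<open>M/(M+1)\<close>.
  The initial error, multiplied by the unbounded factors \<open>v n div v 0\<close>, thus stays bounded, which
  forces it to vanish.\<close>

lemma bounded_ratio_imp_Ints:
  fixes v :: "nat \<Rightarrow> nat" and x M :: real
  assumes pos: "v 0 > 0"
    and dvd: "\<And>n. v 0 dvd v n"
    and ratio: "\<And>n. real (v (Suc n)) \<le> M * real (v n)"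
    and unbounded: "\<And>B. \<exists>n. B < v n"
    and "M \<ge> 0"
    and near: "\<And>n. \<exists>m\<in>\<int>. \<bar>real (v n) * x - m\<bar> < 1 / (M + 1)"
  shows "real (v 0) * x \<in> \<int>"
proof -
  obtain m where m: "m \<in> \<int>" "\<bar>real (v 0) * x - m\<bar> < 1 / (M + 1)"
    using near by blast
  define e where "e = real (v 0) * x - m"
  define c where "c n = real (v n div v 0)" for n
  have v: "real (v n) = c n * real (v 0)" for n
    using dvd[of n] by (simp add: c_def flip: of_nat_mult)
  have small: "\<bar>c n * e\<bar> < 1 / (M + 1)" for n
  proof (induction n)
    case 0
    then show ?case using m pos by (simp add: c_def e_def)
  next
    case (Suc n)
    have "c (Suc n) \<le> M * c n"
      using ratio[of n] pos
      unfolding v[of n] v[of "Suc n"] mult.assoc[symmetric] by simp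
    then have "\<bar>c (Suc n) * e\<bar> \<le> M * \<bar>c n * e\<bar>"
      using mult_right_mono[of "c (Suc n)" "M * c n" "\<bar>e\<bar>"] by (simp add: abs_mult c_def)
    also have "\<dots> \<le> M * (1 / (M + 1))"
      using Suc.IH \<open>M \<ge> 0\<close> by (intro mult_left_mono) auto
    finally have step: "\<bar>c (Suc n) * e\<bar> \<le> M * (1 / (M + 1))" .
    obtain m' where m': "m' \<in> \<int>" "\<bar>real (v (Suc n)) * x - m'\<bar> < 1 / (M + 1)"
      using near by blast
    have "real (v (Suc n)) * x - m' = c (Suc n) * e - (m' - c (Suc n) * m)"
      by (simp add: v[of "Suc n"] e_def algebra_simps)
    then have close: "\<bar>c (Suc n) * e - (m' - c (Suc n) * m)\<bar> < 1 / (M + 1)"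
      using m' by simp
    have "M * (1 / (M + 1)) + 1 / (M + 1) = 1"
      using \<open>M \<ge> 0\<close> by (simp add: field_simps)
    then have "\<bar>m' - c (Suc n) * m\<bar> < 1"
      using step close by linarith
    moreover have "m' - c (Suc n) * m \<in> \<int>"
      using m m' by (simp add: c_def)
    ultimately have "m' - c (Suc n) * m = 0"
      using Ints_nonzero_abs_less1 by blast
    then show ?case using close by simp
  qed
  have "e = 0"
  proof (rule ccontr)
    assume "e \<noteq> 0"
    obtain B :: nat where B: "real (v 0) / \<bar>e\<bar> < real B"
      using reals_Archimedean2 by blast
    obtain n where "B < v n"
      using unbounded by blast
    then have "real (v 0) / \<bar>e\<bar> < c n * real (v 0)"
      using B by (simp flip: v[of n])
    then have "1 < \<bar>c n * e\<bar>"
      using \<open>e \<noteq> 0\<close> pos by (simp add: field_simps abs_mult c_def)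
    moreover have "1 / (M + 1) \<le> 1"
      using \<open>M \<ge> 0\<close> by simp
    ultimately show False
      using small[of n] by linarith
  qed
  then show ?thesis
    using m by (simp add: e_def)
qed

section \<open>Groups generated by reciprocals\<close>

lemma generate_reciprocal:
  assumes "d > 0"
  shows "generate real_group {1 / real d} = {x. real d * x \<in> \<int>}"
proof -
  have "generate real_group {1 / real d} = {of_int k * (1 / real d) | k :: int. True}"
    by (simp add: real_group.generate_pow)
  also have "\<dots> = {x. real d * x \<in> \<int>}"
  proof (intro equalityI subsetI)
    fix x assume "x \<in> {of_int k * (1 / real d) | k :: int. True}"
    then show "x \<in> {x. real d * x \<in> \<int>}"
      using assms by auto
  next
    fix x assume "x \<in> {x. real d * x \<in> \<int>}"
    then obtain k where "real d * x = of_int k"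
      by (auto elim: Ints_cases)
    then have "x = of_int k * (1 / real d)"
      using assms by (simp add: field_simps)
    then show "x \<in> {of_int k * (1 / real d) | k :: int. True}"
      by blast
  qed
  finally show ?thesis .
qed

text \<open>Divisibility makes the groups \<open>(1/a\<^sub>n)\<int>\<close> increase with \<open>n\<close>, so any two elements of their union
  lie in a common one, and the union is already closed under addition.\<close>

lemma generate_reciprocals_chain:
  fixes a :: "nat \<Rightarrow> nat"
  assumes pos: "\<And>n. n \<ge> 1 \<Longrightarrow> a n > 0"
    and chain: "\<And>m n. 1 \<le> m \<Longrightarrow> m \<le> n \<Longrightarrow> a m dvd a n"
  shows "generate real_group {1 / real (a n) | n. 1 \<le> n}
           = (\<Union>n\<in>{1..}. generate real_group {1 / real (a n)})"
proof
  let ?U = "\<Union>n\<in>{1..}. generate real_group {1 / real (a n)}"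
  have U: "x \<in> ?U \<longleftrightarrow> (\<exists>n\<ge>1. real (a n) * x \<in> \<int>)" for x
    using pos by (auto simp: generate_reciprocal Suc_le_eq)
  have up: "real (a n) * x \<in> \<int>" if int: "real (a m) * x \<in> \<int>" and m: "1 \<le> m" and n: "m \<le> n" for m n x
  proof -
    obtain c where "a n = a m * c"
      using chain[OF m n] by blast
    then have "real (a n) * x = real c * (real (a m) * x)"
      by simp
    then show ?thesis
      using int by (simp only: Ints_mult Ints_of_nat)
  qed
  have "subgroup ?U real_group"
  proof (rule real_group.subgroupI)
    have "0 \<in> ?U"
      unfolding U by (intro exI[of _ "1 :: nat"]) simp
    then show "?U \<noteq> {}"
      by blast
    show "inv\<^bsub>real_group\<^esub> x \<in> ?U" if "x \<in> ?U" for x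
      using that unfolding U by auto
    show "x \<otimes>\<^bsub>real_group\<^esub> y \<in> ?U" if xy: "x \<in> ?U" "y \<in> ?U" for x y
    proof -
      obtain m n where m: "1 \<le> m" "real (a m) * x \<in> \<int>"
          and n: "1 \<le> n" "real (a n) * y \<in> \<int>"
        using xy unfolding U by blast
      have "real (a (max m n)) * (x + y) \<in> \<int>"
        unfolding distrib_left
        using up[OF m(2,1) max.cobounded1] up[OF n(2,1) max.cobounded2] by (rule Ints_add)
      moreover have "1 \<le> max m n"
        using m(1) by simp
      ultimately show ?thesis
        unfolding U real_group_simps by blast
    qed
  qed auto
  then show "generate real_group {1 / real (a n) | n. 1 \<le> n} \<subseteq> ?U"
    by (intro real_group.generate_subgroup_incl) (auto intro: generate.incl)
  show "?U \<subseteq> generate real_group {1 / real (a n) | n. 1 \<le> n}"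
    by (intro UN_least real_group.mono_generate) auto
qed

text \<open>Division with remainder shows that \<open>(1/d)\<int>\<close> has only the \<open>d\<close> classes of \<open>0, 1/d, \<dots>, (d-1)/d\<close>
  modulo \<open>\<int>\<close>.\<close>

lemma finite_circle_proj_generate_reciprocal:
  assumes "d > 0"
  shows "finite (circle_proj ` generate real_group {1 / real d})"
proof (rule finite_subset)
  show "circle_proj ` generate real_group {1 / real d}
          \<subseteq> (\<lambda>j. circle_proj (real_of_int j / real d)) ` {0..<int d}"
  proof clarify
    fix x assume "x \<in> generate real_group {1 / real d}"
    then obtain k where k: "real d * x = of_int k"
      using assms by (auto simp: generate_reciprocal elim: Ints_cases)
    have "real_of_int k = of_int (k div int d) * real d + of_int (k mod int d)"
      by (metis div_mult_mod_eq of_int_add of_int_mult of_int_of_nat_eq)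
    then have "x - of_int (k mod int d) / real d = of_int (k div int d)"
      using k assms by (simp add: field_simps)
    then have "circle_proj x = circle_proj (of_int (k mod int d) / real d)"
      by (simp add: circle_proj_eq_iff)
    then show "circle_proj x \<in> (\<lambda>j. circle_proj (real_of_int j / real d)) ` {0..<int d}"
      using assms by auto
  qed
qed simp

section \<open>The characterized subgroup\<close>

theorem theorem2p3:
  fixes u idx a :: "nat \<Rightarrow> nat" and q :: "nat \<Rightarrow> real"
  assumes u0: "u 0 = 1"
    and u_pos: "\<forall>n\<ge>1. 1 \<le> u n"
    and u_mono: "strict_mono_on {1..} u"
    and q: "\<forall>n\<ge>1. q n = real (u n) / real (u (n - 1))"
    and idx_pos: "\<forall>k\<ge>1. 1 \<le> idx k"
    and idx_mono: "strict_mono_on {1..} idx"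
    and a: "\<forall>k\<ge>1. a k = u (idx k)"
    and dvd: "\<forall>i\<ge>1. \<forall>k\<ge>1. idx k \<le> i \<longrightarrow> a k dvd u i"
    and q_bounded: "bounded (q ` {1..})"
  shows "char_subgroup u
           = circle_proj ` generate real_group {1 / real (a n) | n. 1 \<le> n}
       \<and> (\<forall>n\<ge>1. subgroup (generate circle_group {circle_proj (1 / real (a n))}) circle_group
            \<and> finite (generate circle_group {circle_proj (1 / real (a n))}))
       \<and> char_subgroup u
           = (\<Union>n\<in>{1..}. generate circle_group {circle_proj (1 / real (a n))})"
proof -
  have a_pos: "a n > 0" if "n \<ge> 1" for n
    using that a u_pos idx_pos by (simp add: Suc_le_eq)
  have a_chain: "a m dvd a n" if "1 \<le> m" "m \<le> n" for m n
  proof -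
    have "idx m \<le> idx n"
      using strict_mono_on_leD[OF idx_mono] that by simp
    then show ?thesis
      using dvd a idx_pos that by simp
  qed
  have ge_self: "n \<le> f n" if "strict_mono_on {1..} f" "1 \<le> f 1" for f :: "nat \<Rightarrow> nat" and n
  proof (induction n)
    case (Suc n)
    show ?case
    proof (cases "n = 0")
      case True
      then show ?thesis
        using that by simp
    next
      case False
      then have "f n < f (Suc n)"
        using strict_mono_onD[OF that(1)] by simp
      then show ?thesis using Suc.IH by simp
    qed
  qed simp
  obtain M where M: "M \<ge> 0" "\<And>n. n \<ge> 1 \<Longrightarrow> \<bar>q n\<bar> \<le> M"
  proof -
    obtain M where "M > 0" "\<forall>y\<in>q ` {1..}. norm y \<le> M"
      using q_bounded unfolding bounded_pos by blast
    then show thesis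
      by (intro that[of M]) auto
  qed
  have gen_circle: "generate circle_group {circle_proj (1 / real (a n))}
      = circle_proj ` generate real_group {1 / real (a n)}" for n
    using circle_proj.generate_img[of "{1 / real (a n)}"] by simp
  have in_char: "circle_proj x \<in> char_subgroup u \<longleftrightarrow> (\<exists>k\<ge>1. real (a k) * x \<in> \<int>)" for x
  proof
    assume "circle_proj x \<in> char_subgroup u"
    then have "limitin circle_topology (\<lambda>n. circle_proj (real (u n) * x)) \<one>\<^bsub>circle_group\<^esub> sequentially"
      by (simp add: char_subgroup_def circle_proj_pow)
    then obtain N where N: "\<And>n. n \<ge> N \<Longrightarrow> \<exists>m\<in>\<int>. \<bar>real (u n) * x - m\<bar> < 1 / (M + 1)"
      using limitin_circle_imp_near_Ints[of "\<lambda>n. real (u n) * x" "1 / (M + 1)"] M(1)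
      by (auto simp: eventually_sequentially)
    define k where "k = Suc N"
    have k: "k \<ge> 1" "idx k \<ge> N" "idx k \<ge> 1"
      using ge_self[OF idx_mono, of k] idx_pos by (auto simp: k_def)
    have "real (u (idx k + 0)) * x \<in> \<int>"
    proof (rule bounded_ratio_imp_Ints[where v = "\<lambda>n. u (idx k + n)" and M = M])
      fix n
      have "real (u (idx k + Suc n)) = q (idx k + Suc n) * real (u (idx k + n))"
        using q u_pos[rule_format, of "idx k + n"] k by simp
      also have "\<dots> \<le> M * real (u (idx k + n))"
        using M(2)[of "idx k + Suc n"] by (intro mult_right_mono) auto
      finally show "real (u (idx k + Suc n)) \<le> M * real (u (idx k + n))" .
      show "\<exists>j. B < u (idx k + j)" for B
        using ge_self[OF u_mono, of "idx k + Suc B"] u_pos by (intro exI[of _ "Suc B"]) simp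
    qed (use k N M a dvd u_pos in \<open>auto simp: Suc_le_eq\<close>)
    then show "\<exists>k\<ge>1. real (a k) * x \<in> \<int>"
      using k a by auto
  next
    assume "\<exists>k\<ge>1. real (a k) * x \<in> \<int>"
    then obtain k where k: "k \<ge> 1" "real (a k) * x \<in> \<int>"
      by blast
    have "circle_proj (real (u n) * x) = \<one>\<^bsub>circle_group\<^esub>" if "n \<ge> idx k" for n
    proof -
      have "a k dvd u n"
        using dvd idx_pos k that le_trans by blast
      then obtain c where "u n = a k * c"
        by blast
      then have "real (u n) * x = real c * (real (a k) * x)"
        by simp
      then have "real (u n) * x - 0 \<in> \<int>"
        using k by (simp only: diff_zero Ints_mult Ints_of_nat)
      then have "circle_proj (real (u n) * x) = circle_proj 0"
        by (simp only: circle_proj_eq_iff)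
      then show ?thesis
        using circle_proj.hom_one by simp
    qed
    then have ev: "\<forall>\<^sub>F n in sequentially. \<one>\<^bsub>circle_group\<^esub> = circle_proj (real (u n) * x)"
      unfolding eventually_sequentially by metis
    have "limitin circle_topology (\<lambda>n. \<one>\<^bsub>circle_group\<^esub>) \<one>\<^bsub>circle_group\<^esub> sequentially"
      using circle_proj.H.one_closed by (simp add: limitin_const_iff topspace_circle_topology)
    then have "limitin circle_topology (\<lambda>n. circle_proj (real (u n) * x)) \<one>\<^bsub>circle_group\<^esub> sequentially"
      by (rule limitin_transform_eventually[OF ev])
    then show "circle_proj x \<in> char_subgroup u"
      unfolding char_subgroup_def mem_Collect_eq circle_proj_pow carrier_circle_group by blast
  qed
  have char: "char_subgroup u = (\<Union>n\<in>{1..}. circle_proj ` generate real_group {1 / real (a n)})"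
  proof (intro equalityI subsetI)
    fix t assume t: "t \<in> char_subgroup u"
    then obtain x where x: "t = circle_proj x"
      by (auto simp: char_subgroup_def carrier_circle_group)
    then obtain k where "k \<ge> 1" "real (a k) * x \<in> \<int>"
      using t in_char by blast
    then show "t \<in> (\<Union>n\<in>{1..}. circle_proj ` generate real_group {1 / real (a n)})"
      using x by (auto simp: generate_reciprocal a_pos)
  next
    fix t assume "t \<in> (\<Union>n\<in>{1..}. circle_proj ` generate real_group {1 / real (a n)})"
    then show "t \<in> char_subgroup u"
      using a_pos in_char by (auto simp: generate_reciprocal)
  qed
  show ?thesis
  proof (intro conjI allI impI)
    show "char_subgroup u = circle_proj ` generate real_group {1 / real (a n) | n. 1 \<le> n}"
      using generate_reciprocals_chain[of a] a_pos a_chain by (simp add: char image_UN)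
    show "char_subgroup u = (\<Union>n\<in>{1..}. generate circle_group {circle_proj (1 / real (a n))})"
      by (simp add: char gen_circle)
    show "subgroup (generate circle_group {circle_proj (1 / real (a n))}) circle_group" for n
      by (rule circle_proj.H.generate_is_subgroup) (simp add: carrier_circle_group)
    show "finite (generate circle_group {circle_proj (1 / real (a n))})" if "n \<ge> 1" for n
      using finite_circle_proj_generate_reciprocal a_pos that by (simp add: gen_circle)
  qed
qed

end
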